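(* Let $n\ge 2$ and let $E\subset\mathbb{R}^n$ be a closed set that is weakly $(n-1)$-convex but not $(n-1)$-convex. Then $E$ consists of not less than three connected components.
   Context: Let $n\ge 2$ and $1\le m<n$. An $m$-dimensional plane is an $m$-dimensional affine subspace of $\mathbb{R}^n$. A set $E\subset\mathbb{R}^n$ is $m$-convex with respect to a point $x\in\mathbb{R}^n\setminus E$ if there exists an $m$-dimensional plane $L$ with $x\in L$ and $L\cap E=\varnothing$. A set $E$ is $m$-convex if it is $m$-convex with respect to every point $x\in\mathbb{R}^n\setminus E$. An open set $G\subset\mathbb{R}^n$ is weakly $m$-convex if it is $m$-convex with respect to every point $x\in\partial G$. A set $A$ is approximated from the outside by a family of open sets $A_k$, $k=1,2,\ldots$, if $\overline{A_{k+1}}\subset A_k$ for all $k$ and $A=\bigcap_k A_k$. A closed set $E\subset\mathbb{R}^n$ is weakly $m$-convex if it can be approximated from the outside by a family of open weakly $m$-convex sets $A_k$, $k=1,2,\ldots$. *)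

theory Defs
  imports "HOL-Analysis.Analysis"
begin

definition plane :: "nat \<Rightarrow> 'a::euclidean_space set \<Rightarrow> bool" where
  "plane m L \<longleftrightarrow> affine L \<and> aff_dim L = int m"

definition m_convex_at :: "nat \<Rightarrow> 'a::euclidean_space set \<Rightarrow> 'a \<Rightarrow> bool" where
  "m_convex_at m E x \<longleftrightarrow> (\<exists>L. plane m L \<and> x \<in> L \<and> L \<inter> E = {})"

definition m_convex :: "nat \<Rightarrow> 'a::euclidean_space set \<Rightarrow> bool" where
  "m_convex m E \<longleftrightarrow> (\<forall>x. x \<notin> E \<longrightarrow> m_convex_at m E x)"

definition open_weakly_m_convex :: "nat \<Rightarrow> 'a::euclidean_space set \<Rightarrow> bool" where
  "open_weakly_m_convex m G \<longleftrightarrow> open G \<and> (\<forall>x \<in> frontier G. m_convex_at m G x)"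

text \<open>The approximating sequence is indexed from 0 instead of from 1.\<close>

definition approximated_from_outside ::
    "'a::euclidean_space set \<Rightarrow> (nat \<Rightarrow> 'a set) \<Rightarrow> bool" where
  "approximated_from_outside E A \<longleftrightarrow>
     (\<forall>k. open (A k)) \<and> (\<forall>k. closure (A (Suc k)) \<subseteq> A k) \<and> E = (\<Inter>k. A k)"

definition closed_weakly_m_convex :: "nat \<Rightarrow> 'a::euclidean_space set \<Rightarrow> bool" where
  "closed_weakly_m_convex m E \<longleftrightarrow>
     closed E \<and>
     (\<exists>A. approximated_from_outside E A \<and> (\<forall>k. open_weakly_m_convex m (A k)))"

end

theory Submission
  imports Defs
begin

text \<open>
  Every component of an open weakly \<open>(n - 1)\<close>-convex set is convex, since it has a supporting
  hyperplane at each of its frontier points. If \<open>E\<close> has at most two components, it is covered by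
  two (possibly equal) components \<open>C\<close>, \<open>D\<close> of an approximating set that misses the given point
  \<open>x\<close>. If no hyperplane through \<open>x\<close> misses \<open>C \<union> D\<close>, then by separation some ray from \<open>x\<close> meets
  both \<open>C\<close> and \<open>D\<close>, and \<open>x\<close> lies between a point of \<open>C\<close> and a point of \<open>D\<close>. Say the ray meets
  \<open>C\<close> no later than \<open>D\<close>; the hyperplane at the point where the ray enters \<open>C\<close> then leaves \<open>C\<close>
  and \<open>D\<close> on one side and \<open>x\<close> on the other, which contradicts the betweenness.
\<close>

section \<open>Hyperplanes as level sets, and half-spaces at frontier points\<close>

lemma plane_hyperplane:
  fixes a :: "'a::euclidean_space"
  assumes "a \<noteq> 0"
  shows "plane (DIM('a) - 1) {y. a \<bullet> y = b}"
proof -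
  have "DIM('a) \<ge> 1" by (simp add: Suc_leI)
  then show ?thesis
    using assms by (simp add: plane_def affine_hyperplane of_nat_diff)
qed

lemma planeE_hyperplane:
  fixes L :: "'a::euclidean_space set"
  assumes "plane (DIM('a) - 1) L"
  obtains a b where "a \<noteq> 0" "L = {y. a \<bullet> y = b}"
proof -
  have L: "aff_dim L = int (DIM('a) - 1)" "affine hull L = L"
    using assms unfolding plane_def affine_hull_eq by blast+
  obtain a b where "a \<noteq> 0" "affine hull L = {y. a \<bullet> y = b}"
    using iffD1[OF aff_dim_eq_hyperplane L(1)] by blast
  then show thesis unfolding L(2) by (rule that)
qed

lemma connected_avoids_hyperplane_cases:
  fixes C :: "'a::euclidean_space set"
  assumes "connected C" "\<And>c. c \<in> C \<Longrightarrow> a \<bullet> c \<noteq> b"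
  shows "(\<forall>c\<in>C. b < a \<bullet> c) \<or> (\<forall>c\<in>C. a \<bullet> c < b)"
proof (rule ccontr)
  assume "\<not> ?thesis"
  then obtain c d where "c \<in> C" "d \<in> C" "a \<bullet> c \<le> b" "b \<le> a \<bullet> d"
    by (auto simp: not_less)
  then obtain z where "z \<in> C" "a \<bullet> z = b"
    using connected_ivt_hyperplane[OF assms(1)] by blast
  then show False using assms(2) by blast
qed

text \<open>A connected \<open>C\<close> that misses the plane lies on one side of it, and the sign
  of \<open>a\<close> is chosen so that this is the upper side. The last conclusion keeps the
  avoidance of all of \<open>G\<close>, because the side on which another component lies is still
  unknown.\<close>

lemma strict_halfspace_at_frontier:
  fixes C :: "'a::euclidean_space set"
  assumes "connected C" "m_convex_at (DIM('a) - 1) G p" "C \<subseteq> G"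
  obtains a where "a \<noteq> 0" "\<And>c. c \<in> C \<Longrightarrow> a \<bullet> p < a \<bullet> c" "\<And>g. g \<in> G \<Longrightarrow> a \<bullet> g \<noteq> a \<bullet> p"
proof -
  obtain L where L: "plane (DIM('a) - 1) L" "p \<in> L" "L \<inter> G = {}"
    using assms(2) unfolding m_convex_at_def by blast
  obtain a b where a: "a \<noteq> 0" "L = {y. a \<bullet> y = b}"
    using planeE_hyperplane[OF L(1)] .
  have b: "b = a \<bullet> p" using L(2) a by simp
  have G: "a \<bullet> g \<noteq> a \<bullet> p" if "g \<in> G" for g
    using that L(3) a b by auto
  consider "\<forall>c\<in>C. a \<bullet> p < a \<bullet> c" | "\<forall>c\<in>C. a \<bullet> c < a \<bullet> p"
    using connected_avoids_hyperplane_cases[OF assms(1)] G assms(3) by blast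
  then show thesis
  proof cases
    case 1
    then show ?thesis using that[of a] a(1) G by blast
  next
    case 2
    then show ?thesis using that[of "- a"] a(1) G by auto
  qed
qed

lemma closed_segment_Int_frontier:
  fixes C :: "'a::euclidean_space set"
  assumes "y \<in> C" "x \<notin> C"
  obtains t where "0 \<le> t" "t \<le> 1" "x + t *\<^sub>R (y - x) \<in> frontier C"
proof -
  have "closed_segment x y \<inter> frontier C \<noteq> {}"
    using assms by (intro connected_Int_frontier) auto
  then obtain t where "0 \<le> t" "t \<le> 1" "(1 - t) *\<^sub>R x + t *\<^sub>R y \<in> frontier C"
    by (auto simp: in_segment)
  then show thesis using that[of t] by (simp add: algebra_simps)
qed

text \<open>A segment that joins two points of \<open>C\<close> and leaves \<open>C\<close> meets
  the frontier at some \<open>p\<close>. The open half-space at \<open>p\<close> contains both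
  endpoints, hence the whole segment, but not \<open>p\<close>.\<close>

lemma convex_if_hyperplanes_at_frontier:
  fixes C :: "'a::euclidean_space set"
  assumes "connected C" "\<And>p. p \<in> frontier C \<Longrightarrow> m_convex_at (DIM('a) - 1) C p"
  shows "convex C"
  unfolding convex_contains_segment
proof (intro ballI subsetI, rule ccontr)
  fix u v w assume uv: "u \<in> C" "v \<in> C" and w: "w \<in> closed_segment u v" "w \<notin> C"
  have "closed_segment u v \<inter> frontier C \<noteq> {}"
    using uv w by (intro connected_Int_frontier) auto
  then obtain p where p: "p \<in> closed_segment u v" "p \<in> frontier C" by blast
  obtain a where a: "\<And>c. c \<in> C \<Longrightarrow> a \<bullet> p < a \<bullet> c"
    using strict_halfspace_at_frontier[OF assms(1) assms(2)[OF p(2)]] by blast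
  have "closed_segment u v \<subseteq> {y. a \<bullet> p < a \<bullet> y}"
    using uv a by (intro closed_segment_subset convex_halfspace_gt) auto
  then show False using p(1) by auto
qed

lemma open_halfspace_strict:
  fixes C :: "'a::euclidean_space set"
  assumes "open C" "a \<noteq> 0" "\<And>c. c \<in> C \<Longrightarrow> b \<le> a \<bullet> c" "c \<in> C"
  shows "b < a \<bullet> c"
proof -
  have "C \<subseteq> interior {y. a \<bullet> y \<ge> b}"
    using assms by (intro interior_maximal) auto
  then show ?thesis using assms(2,4) by (auto simp: interior_halfspace_ge)
qed

section \<open>Separation by a hyperplane through a given point\<close>

lemma convex_positive_multiples:
  fixes C :: "'a::real_vector set"
  assumes "convex C"
  shows "convex {s *\<^sub>R (c - x) |s c. s > 0 \<and> c \<in> C}" (is "convex ?K")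
proof (rule convexI)
  fix y z and u v :: real
  assume "y \<in> ?K" "z \<in> ?K" and uv: "0 \<le> u" "0 \<le> v" "u + v = 1"
  then obtain s c t d where st: "s > 0" "t > 0" and cd: "c \<in> C" "d \<in> C"
    and yz: "y = s *\<^sub>R (c - x)" "z = t *\<^sub>R (d - x)" by blast
  define r where "r = u * s + v * t"
  have r: "r > 0"
  proof (cases "u = 0")
    case True
    then show ?thesis using uv st by (simp add: r_def)
  next
    case False
    then show ?thesis using uv st by (simp add: r_def add_pos_nonneg)
  qed
  \<comment> \<open>Up to the factor \<open>r\<close>, the combination of the two multiples comes
    from the point of \<open>C\<close> whose weights \<open>u * s\<close> and \<open>v * t\<close>
    are normalised to sum 1.\<close>
  define e where "e = (u * s / r) *\<^sub>R c + (v * t / r) *\<^sub>R d"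
  have "u * s / r + v * t / r = 1"
    using r by (simp add: add_divide_distrib[symmetric] r_def[symmetric])
  then have "e \<in> C"
    unfolding e_def using assms cd uv st r by (intro convexD) auto
  have "r *\<^sub>R e = (u * s) *\<^sub>R c + (v * t) *\<^sub>R d"
    using r by (simp add: e_def scaleR_add_right)
  then have "u *\<^sub>R y + v *\<^sub>R z = r *\<^sub>R (e - x)"
    by (simp add: yz r_def algebra_simps)
  then show "u *\<^sub>R y + v *\<^sub>R z \<in> ?K" using r \<open>e \<in> C\<close> by blast
qed

text \<open>The hypothesis \<open>disj\<close> says that no ray from \<open>x\<close> meets both
  sets, so the cones over \<open>C - x\<close> and \<open>D - x\<close> are disjoint and can be
  separated. Invariance of the cones under scaling moves the hyperplane to their apex, and openness
  makes the inequalities strict.\<close>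

lemma separating_hyperplane_through:
  fixes C D :: "'a::euclidean_space set"
  assumes "open C" "open D" "convex C" "convex D" "C \<noteq> {}" "D \<noteq> {}"
    and disj: "\<And>s t c d. \<lbrakk>s > 0; t > 0; c \<in> C; d \<in> D\<rbrakk> \<Longrightarrow> s *\<^sub>R (c - x) \<noteq> t *\<^sub>R (d - x)"
  obtains a where "a \<noteq> 0" "\<And>c. c \<in> C \<Longrightarrow> a \<bullet> c < a \<bullet> x" "\<And>d. d \<in> D \<Longrightarrow> a \<bullet> x < a \<bullet> d"
proof -
  let ?K = "\<lambda>C. {s *\<^sub>R (c - x) |s c. s > 0 \<and> c \<in> C}"
  have ne: "?K C \<noteq> {}" "?K D \<noteq> {}"
    using assms(5,6) zero_less_one by blast+
  obtain a b where a: "a \<noteq> 0" "\<forall>y\<in>?K C. a \<bullet> y \<le> b" "\<forall>y\<in>?K D. b \<le> a \<bullet> y"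
    using separating_hyperplane_sets[OF convex_positive_multiples[OF assms(3), of x]
        convex_positive_multiples[OF assms(4), of x] ne] disj by blast
  have K: "s * (a \<bullet> (c - x)) \<le> t * (a \<bullet> (d - x))" if "s > 0" "t > 0" "c \<in> C" "d \<in> D" for s t c d
  proof -
    have "a \<bullet> (s *\<^sub>R (c - x)) \<le> b" "b \<le> a \<bullet> (t *\<^sub>R (d - x))"
      using a that by blast+
    then show ?thesis by simp
  qed
  \<comment> \<open>With \<open>t = 1\<close>, a positive \<open>p\<close> would make the left side
    exceed \<open>q\<close> for large \<open>s\<close>; the value
    \<open>s = (\<bar>q\<bar> + 1) / p\<close> is large enough.\<close>
  have pinch: "p \<le> 0" if "\<And>s t. \<lbrakk>s > 0; t > 0\<rbrakk> \<Longrightarrow> s * p \<le> t * q" for p q :: real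
  proof (rule ccontr)
    assume "\<not> p \<le> 0"
    moreover have "((\<bar>q\<bar> + 1) / p) * p \<le> 1 * q"
      using calculation by (intro that) (auto intro!: divide_pos_pos)
    ultimately show False by (auto split: abs_split)
  qed
  obtain c0 d0 where c0: "c0 \<in> C" "d0 \<in> D" using assms(5,6) by blast
  have C: "a \<bullet> (c - x) \<le> 0" if "c \<in> C" for c
    using pinch[of "a \<bullet> (c - x)" "a \<bullet> (d0 - x)"] K c0 that by blast
  \<comment> \<open>The same argument with the two cones exchanged and the signs reversed.\<close>
  have D: "0 \<le> a \<bullet> (d - x)" if "d \<in> D" for d
    using pinch[of "- (a \<bullet> (d - x))" "- (a \<bullet> (c0 - x))"] K c0 that by fastforce
  have "- (a \<bullet> x) < - a \<bullet> c" if "c \<in> C" for c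
    using a(1) C that by (intro open_halfspace_strict[OF assms(1)]) (auto simp: inner_diff_right)
  moreover have "a \<bullet> x < a \<bullet> d" if "d \<in> D" for d
    using a(1) D that by (intro open_halfspace_strict[OF assms(2)]) (auto simp: inner_diff_right)
  ultimately show thesis using that[of a] a(1) by simp
qed

section \<open>Two components and a point outside them\<close>

text \<open>Along the ray from \<open>x\<close> through \<open>y\<close>, \<open>C\<close> is met at
  parameter 1 and \<open>D\<close> at \<open>r \<ge> 1\<close>, while \<open>opp\<close> places
  \<open>x\<close> strictly between \<open>z\<close> and \<open>w\<close>. A hyperplane at a
  frontier point of \<open>C\<close> before \<open>y\<close> has both sets strictly above it and
  \<open>x\<close> on or below it, so \<open>x\<close> cannot lie between them.\<close>

lemma ray_entry_contradiction:
  fixes C D :: "'a::euclidean_space set"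
  assumes "connected C" "connected D"
    and fr: "\<And>p. p \<in> frontier C \<Longrightarrow> m_convex_at (DIM('a) - 1) (C \<union> D) p"
    and x: "x \<notin> C"
    and ray: "y \<in> C" "x + r *\<^sub>R (y - x) \<in> D" "r \<ge> 1"
    and opp: "z \<in> C" "w \<in> D" "s > 0" "t > 0" "s *\<^sub>R (z - x) + t *\<^sub>R (w - x) = 0"
  shows False
proof -
  obtain l where l: "0 \<le> l" "l \<le> 1" "x + l *\<^sub>R (y - x) \<in> frontier C"
    using closed_segment_Int_frontier[OF ray(1) x] .
  define p where "p = x + l *\<^sub>R (y - x)"
  obtain a where a: "\<And>c. c \<in> C \<Longrightarrow> a \<bullet> p < a \<bullet> c" "\<And>g. g \<in> C \<union> D \<Longrightarrow> a \<bullet> g \<noteq> a \<bullet> p"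
    using strict_halfspace_at_frontier[OF assms(1) fr[OF l(3)] Un_upper1, folded p_def] by metis
  define k where "k = a \<bullet> (y - x)"
  have p: "a \<bullet> p = a \<bullet> x + l * k"
    by (simp add: p_def k_def inner_add_right)
  have "a \<bullet> x + l * k < a \<bullet> x + k"
    using a(1)[OF ray(1)] by (simp add: p k_def inner_diff_right)
  \<comment> \<open>Since \<open>l \<le> 1\<close>, both factors must be positive: the functional
    grows along the ray, and the frontier point comes strictly before \<open>y\<close>.\<close>
  then have "0 < (1 - l) * k" by (simp add: algebra_simps)
  then have k: "k > 0" "l < 1"
    using l(2) by (auto simp: zero_less_mult_iff)
  have "l * k < r * k" using k ray(3) by (intro mult_strict_right_mono) auto
  then have "a \<bullet> p < a \<bullet> (x + r *\<^sub>R (y - x))"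
    by (simp add: p inner_add_right k_def)
  \<comment> \<open>One point of \<open>D\<close> is above the hyperplane, and the connected set
    \<open>D\<close> avoids it, so all of \<open>D\<close> is above.\<close>
  then have "a \<bullet> p < a \<bullet> w"
    using connected_avoids_hyperplane_cases[OF assms(2), of a "a \<bullet> p"] a(2) ray(2) opp(2)
    by fastforce
  moreover have "a \<bullet> p < a \<bullet> z" using a(1) opp(1) .
  moreover have "a \<bullet> x \<le> a \<bullet> p" using p k l by simp
  ultimately have "0 < s * (a \<bullet> (z - x))" "0 < t * (a \<bullet> (w - x))"
    using opp(3,4) by (auto simp: inner_diff_right)
  moreover have "s * (a \<bullet> (z - x)) + t * (a \<bullet> (w - x)) = 0"
    using arg_cong[OF opp(5), of "inner a"] by (simp add: inner_add_right)
  ultimately show False by linarith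
qed

lemma m_convex_at_Un:
  fixes C D :: "'a::euclidean_space set"
  assumes "open C" "open D" "connected C" "connected D" "C \<noteq> {}" "D \<noteq> {}"
    and fr: "\<And>p. p \<in> frontier C \<union> frontier D \<Longrightarrow> m_convex_at (DIM('a) - 1) (C \<union> D) p"
    and x: "x \<notin> C \<union> D"
  shows "m_convex_at (DIM('a) - 1) (C \<union> D) x"
proof (rule ccontr)
  assume not: "\<not> ?thesis"
  have conv: "convex C" "convex D"
    using fr assms(3,4)
    by (intro convex_if_hyperplanes_at_frontier; fastforce simp: m_convex_at_def)+
  have no_hyp: False if "a \<noteq> 0" "\<And>g. g \<in> C \<union> D \<Longrightarrow> a \<bullet> g \<noteq> a \<bullet> x" for a
    using not plane_hyperplane[OF that(1), of "a \<bullet> x"] that(2)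
    unfolding m_convex_at_def by blast
  \<comment> \<open>If no ray from \<open>x\<close> met both sets, a hyperplane through
    \<open>x\<close> would separate them strictly and so miss both.\<close>
  obtain s t c d where same: "s > 0" "t > 0" "c \<in> C" "d \<in> D" "s *\<^sub>R (c - x) = t *\<^sub>R (d - x)"
  proof (rule ccontr)
    assume "\<not> thesis"
    then have "\<And>s t c d. \<lbrakk>s > 0; t > 0; c \<in> C; d \<in> D\<rbrakk> \<Longrightarrow> s *\<^sub>R (c - x) \<noteq> t *\<^sub>R (d - x)"
      using that by blast
    then obtain a where "a \<noteq> 0" "\<And>c. c \<in> C \<Longrightarrow> a \<bullet> c < a \<bullet> x" "\<And>d. d \<in> D \<Longrightarrow> a \<bullet> x < a \<bullet> d"
      using separating_hyperplane_through[OF assms(1,2) conv assms(5,6), of x] by metis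
    then show False using no_hyp[of a] by fastforce
  qed
  obtain s' t' z w where opp: "s' > 0" "t' > 0" "z \<in> C" "w \<in> D"
    "s' *\<^sub>R (z - x) + t' *\<^sub>R (w - x) = 0"
  proof (rule ccontr)
    assume "\<not> thesis"
    then have no: "\<And>s t c d. \<lbrakk>s > 0; t > 0; c \<in> C; d \<in> D\<rbrakk> \<Longrightarrow> s *\<^sub>R (c - x) + t *\<^sub>R (d - x) \<noteq> 0"
      using that by blast
    \<comment> \<open>\<open>?R\<close> is the reflection of \<open>D\<close> in \<open>x\<close>: a
      ray from \<open>x\<close> meeting \<open>C\<close> and \<open>?R\<close> puts \<open>x\<close>
      between points of \<open>C\<close> and \<open>D\<close>. A hyperplane through \<open>x\<close>
      separating \<open>C\<close> from \<open>?R\<close> would have \<open>C\<close> and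
      \<open>D\<close> on the same side and miss both.\<close>
    let ?R = "(\<lambda>y. 2 *\<^sub>R x - y) ` D"
    have R: "open ?R" "convex ?R" "?R \<noteq> {}"
      using assms(2,6) open_neg_translation convex_affinity[OF conv(2), of "2 *\<^sub>R x" "-1"] by auto
    have "s *\<^sub>R (c - x) \<noteq> t *\<^sub>R (d - x)" if "s > 0" "t > 0" "c \<in> C" "d \<in> ?R" for s t c d
    proof
      assume eq: "s *\<^sub>R (c - x) = t *\<^sub>R (d - x)"
      obtain e where e: "e \<in> D" "d = 2 *\<^sub>R x - e" using \<open>d \<in> ?R\<close> by blast
      have "d - x = - (e - x)" unfolding e(2) by (simp add: scaleR_2)
      then have "s *\<^sub>R (c - x) + t *\<^sub>R (e - x) = 0" using eq by (simp only: scaleR_minus_right) simp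
      then show False using no that e(1) by blast
    qed
    then obtain a where a: "a \<noteq> 0" "\<And>c. c \<in> C \<Longrightarrow> a \<bullet> c < a \<bullet> x" "\<And>d. d \<in> ?R \<Longrightarrow> a \<bullet> x < a \<bullet> d"
      using separating_hyperplane_through[OF assms(1) R(1) conv(1) R(2) assms(5) R(3), of x] by metis
    have "a \<bullet> d < a \<bullet> x" if "d \<in> D" for d
      using a(3)[of "2 *\<^sub>R x - d"] that by (auto simp: inner_diff_right)
    then show False using no_hyp[of a] a by fastforce
  qed
  \<comment> \<open>Relative to \<open>c\<close>, the point \<open>d\<close> has ray parameter
    \<open>s / t\<close>. So \<open>s \<ge> t\<close> means that \<open>c\<close> comes no later
    than \<open>d\<close>; otherwise \<open>C\<close> and \<open>D\<close> exchange roles.\<close>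
  show False
  proof (cases "s \<ge> t")
    case True
    have "d = x + (s / t) *\<^sub>R (c - x)"
      using arg_cong[OF same(5), of "scaleR (1 / t)"] same(2) by simp
    then show False
      using ray_entry_contradiction[OF assms(3,4) fr, of x c "s / t" z w s' t'] x same opp True by auto
  next
    case False
    have "c = x + (t / s) *\<^sub>R (d - x)"
      using arg_cong[OF same(5), of "scaleR (1 / s)"] same(1) by (simp add: diff_eq_eq add.commute)
    moreover have "t' *\<^sub>R (w - x) + s' *\<^sub>R (z - x) = 0" using opp(5) by (simp add: add.commute)
    moreover have "m_convex_at (DIM('a) - 1) (D \<union> C) p" if "p \<in> frontier D" for p
      using fr[of p] that by (simp add: Un_commute)
    ultimately show False
      using ray_entry_contradiction[OF assms(4,3), of x d "t / s" w z t' s'] x same opp False by auto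
  qed
qed

section \<open>Passing from the approximating set to \<open>E\<close>\<close>

lemma m_convex_at_mono:
  assumes "m_convex_at m G x" "E \<subseteq> G"
  shows "m_convex_at m E x"
  using assms unfolding m_convex_at_def by blast

text \<open>Frontier points of a component are frontier points of \<open>A\<close>, where weak
  convexity supplies a plane missing all of \<open>A\<close>. The case \<open>C = D\<close> is
  included.\<close>

lemma m_convex_at_components_Un:
  fixes A :: "'a::euclidean_space set"
  assumes A: "open_weakly_m_convex (DIM('a) - 1) A"
    and CD: "C \<in> components A" "D \<in> components A" and x: "x \<notin> A"
  shows "m_convex_at (DIM('a) - 1) (C \<union> D) x"
proof (rule m_convex_at_Un)
  have sub: "C \<union> D \<subseteq> A" using CD in_components_subset by blast
  show "m_convex_at (DIM('a) - 1) (C \<union> D) p" if "p \<in> frontier C \<union> frontier D" for p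
  proof (rule m_convex_at_mono[OF _ sub])
    have "p \<in> frontier A" using that CD frontier_of_components_subset by blast
    then show "m_convex_at (DIM('a) - 1) A p" using A by (simp add: open_weakly_m_convex_def)
  qed
  show "x \<notin> C \<union> D" using sub x by blast
  have "open A" using A by (simp add: open_weakly_m_convex_def)
  then show "open C" "open D" using CD open_components by blast+
  show "connected C" "connected D" "C \<noteq> {}" "D \<noteq> {}"
    using CD in_components_connected in_components_nonempty by blast+
qed

text \<open>Allowing \<open>a = b\<close> treats one and two components of \<open>E\<close>
  together.\<close>

lemma card_le_2_subset_pair:
  assumes "finite S" "card S < 3" "S \<noteq> {}"
  obtains a b where "S = {a, b}"
proof -
  have "card S = 1 \<or> card S = 2" using assms card_gt_0_iff[of S] by linarith
  then show thesis using that by (metis card_1_singletonE card_2_iff insert_absorb2)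
qed

theorem theorem2:
  fixes E :: "(real ^ 'n) set"
  assumes "CARD('n) \<ge> 2"
    and "closed E"
    and "closed_weakly_m_convex (CARD('n) - 1) E"
    and "\<not> m_convex (CARD('n) - 1) E"
  shows "infinite (components E) \<or> card (components E) \<ge> 3"
proof (rule ccontr)
  have dim: "DIM(real ^ 'n) - 1 = CARD('n) - 1" by simp
  assume "\<not> ?thesis"
  then have few: "finite (components E)" "card (components E) < 3" by auto
  obtain x where x: "x \<notin> E" and not: "\<not> m_convex_at (CARD('n) - 1) E x"
    using assms(4) unfolding m_convex_def by blast
  \<comment> \<open>Any hyperplane through \<open>x\<close> misses the empty set.\<close>
  have "E \<noteq> {}"
  proof
    assume "E = {}"
    moreover obtain i :: "real ^ 'n" where "i \<in> Basis" using nonempty_Basis by blast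
    ultimately have "m_convex_at (CARD('n) - 1) E x"
      using plane_hyperplane[of i "i \<bullet> x", unfolded dim] nonzero_Basis unfolding m_convex_at_def by blast
    then show False using not by blast
  qed
  then have "components E \<noteq> {}" by simp
  then obtain P Q where PQ: "components E = {P, Q}"
    using card_le_2_subset_pair[OF few] by blast
  then have E: "E = P \<union> Q" using Union_components[of E] by simp
  obtain A :: "nat \<Rightarrow> (real ^ 'n) set"
    where A: "\<And>k. open_weakly_m_convex (CARD('n) - 1) (A k)" "E = (\<Inter>k. A k)"
    using assms(3) unfolding closed_weakly_m_convex_def approximated_from_outside_def by blast
  obtain k where k: "x \<notin> A k" using x A(2) by blast
  \<comment> \<open>Each component of \<open>E\<close> is a nonempty connected subset of
    \<open>A k\<close>, so it lies in a single component of \<open>A k\<close>; different ones may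
    share it.\<close>
  have cover: "\<exists>C \<in> components (A k). R \<subseteq> C" if "R \<in> components E" for R
  proof -
    have "R \<noteq> {}" "R \<subseteq> A k" "connected R"
      using that A(2) in_components_nonempty in_components_subset in_components_connected by blast+
    then show ?thesis using exists_component_superset[of R "A k"] by (metis subset_empty)
  qed
  obtain C D where CD: "C \<in> components (A k)" "D \<in> components (A k)" "P \<subseteq> C" "Q \<subseteq> D"
    using cover[of P] cover[of Q] PQ by blast
  have "m_convex_at (CARD('n) - 1) (C \<union> D) x"
    using m_convex_at_components_Un[of "A k", unfolded dim] A(1) CD k by blast
  then show False
    using m_convex_at_mono not E CD by blast
qed

end
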